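(* For each $f(x_1,\ldots,x_n/a_1,\ldots,a_m)$ in ${\sf PCSF}$ there exists a polynomial $p_f$ such that for all hereditarily finite sets $X_1,\ldots,X_n$ and $A_1,\ldots,A_m$, \[cT(f(X_1,\ldots,X_n/A_1,\ldots,A_m))\le p_f(cT(X_1),\ldots,cT(X_n))+cT(A_1\cup\cdots\cup A_m),\] where $cT(X)=\mathrm{card}(\mathrm{TC}(X))$ is the cardinality of the transitive closure of $X$.
   Context: Functions are set-theoretic functions on the universe of sets, written $f(x_1,\ldots,x_n/a_1,\ldots,a_m)$: arguments before the slash are called normal, after it safe (either list may be empty, written $-$). The class ${\sf PCSF}^-$ consists of functions with no normal arguments; it contains the projections $\pi^{-,m}_j(-/a_1,\ldots,a_m)=a_j$, $\mathrm{pair}(-/a,b)=\{a,b\}$, $\mathrm{null}(-/-)=\emptyset$, $\mathrm{union}(-/a)=\bigcup a$, and $\mathrm{Cond}_\in(-/a,b,c,d)$, which equals $a$ if $c\in d$ and $b$ otherwise; and it is closed under composition $f(-/\vec a)=h(-/t_1(-/\vec a),\ldots,t_k(-/\vec a))$ and under safe separation: if $h(-/\vec a,b)\in{\sf PCSF}^-$ then $f(-/\vec a,c)=\{b\in c: h(-/\vec a,b)\neq\emptyset\}\in{\sf PCSF}^-$. The class ${\sf PCSF}$ is the smallest class containing ${\sf PCSF}^-$ and all projections $\pi^{n,m}_j(x_1,\ldots,x_n/x_{n+1},\ldots,x_{n+m})=x_j$ ($1\le j\le n+m$), and closed under safe composition $f(\vec x/\vec a)=h(r_1(\vec x/-),\ldots,r_k(\vec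 x/-)/t_1(\vec x/\vec a),\ldots,t_l(\vec x/\vec a))$ (with $h,r_i,t_j\in{\sf PCSF}$, the $r_i$ having no safe arguments) and predicative set recursion $f(x,\vec y/\vec a)=h(x,\vec y/\vec a,\{f(z,\vec y/\vec a): z\in x\})$ (with $h\in{\sf PCSF}$). $\mathrm{TC}(X)$ is the transitive closure of $X$; the empty union ($m=0$) is $\emptyset$. *)

theory Defs
  imports "HOL-Library.Extended_Nat" "HOL-Library.Poly_Mapping" "HOL-Library.Countable_Set_Type"
begin

section \<open>Universes of sets\<close>

text \<open>HOL has no type of all sets, so the universe is an arbitrary well-founded extensional
  structure satisfying the (second-order) axioms of pairing, union, separation and replacement.
  Power set, infinity and choice are not required; nothing below needs them, and without them both
  a universe of ZFC and the universe of hereditarily finite sets are covered.\<close>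

class set_universe =
  fixes elts :: "'a \<Rightarrow> 'a set"
  assumes elts_ext: "elts x = elts y \<Longrightarrow> x = y"
    and elts_wf: "wf {(x, y). x \<in> elts y}"
    and ex_pairing: "\<exists>z. elts z = {x, y}"
    and ex_union: "\<exists>z. elts z = (\<Union>y\<in>elts x. elts y)"
    and ex_separation: "\<exists>z. elts z = {y \<in> elts x. P y}"
    and ex_replacement: "\<exists>z. elts z = F ` elts x"

text \<open>The element of the universe with the given members; unspecified if there is none.\<close>

definition vset :: "'a set \<Rightarrow> 'a::set_universe" where
  "vset S = (THE x. elts x = S)"

lemma elts_vset: "\<exists>x. elts x = S \<Longrightarrow> elts (vset S :: 'a::set_universe) = S"
  unfolding vset_def by (rule theI') (metis elts_ext)

lemma elts_vset_pair: "elts (vset {x, y}) = {x, y}"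
  by (rule elts_vset) (rule ex_pairing)

lemma elts_vset_Union: "elts (vset (\<Union>y\<in>elts x. elts y)) = (\<Union>y\<in>elts x. elts y)"
  by (rule elts_vset) (rule ex_union)

lemma elts_vset_sep: "elts (vset {y \<in> elts x. P y}) = {y \<in> elts x. P y}"
  by (rule elts_vset) (rule ex_separation[of x P])

lemma elts_vset_image:
  fixes F :: "'a::set_universe \<Rightarrow> 'a"
  shows "elts (vset (F ` elts x)) = F ` elts x"
  by (rule elts_vset) (rule ex_replacement[of F x])

lemma elts_vset_empty: "elts (vset {} :: 'a::set_universe) = {}"
  using elts_vset_sep[of undefined "\<lambda>_. False"] by simp

lemma elts_vset_finite_Union:
  assumes "finite B"
  shows "elts (vset (\<Union>b\<in>B. elts b)) = (\<Union>b\<in>B. elts (b :: 'a::set_universe))"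
proof -
  have "\<exists>u. elts u = (\<Union>b\<in>B. elts b)"
    using assms
  proof (induction B)
    case empty
    show ?case using elts_vset_empty by auto
  next
    case (insert b B)
    then obtain u where u: "elts u = (\<Union>b\<in>B. elts b)" by blast
    obtain p where p: "elts p = {b, u}" using ex_pairing by blast
    obtain w where "elts w = (\<Union>y\<in>elts p. elts y)" using ex_union by blast
    with u p show ?case by auto
  qed
  then show ?thesis by (rule elts_vset)
qed

text \<open>The hereditarily countable sets are an example of a universe (with infinite members).\<close>

datatype hcset = HC (hc_elts: "hcset cset")

instantiation hcset :: set_universe
begin

definition elts_hcset :: "hcset \<Rightarrow> hcset set" where
  "elts_hcset x = rcset (hc_elts x)"

lemma ex_elts_hcset:
  assumes "countable S"
  shows "\<exists>z :: hcset. elts z = S"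
  by (rule exI[of _ "HC (acset S)"]) (simp add: elts_hcset_def acset_inverse assms)

lemma countable_elts_hcset: "countable (elts (x :: hcset))"
  using rcset[of "hc_elts x"] by (simp add: elts_hcset_def)

instance
proof
  fix x y :: hcset
  assume "elts x = elts y"
  then show "x = y"
    by (simp add: elts_hcset_def rcset_inject hcset.expand)
next
  show "wf {(x, y :: hcset). x \<in> elts y}"
  proof (rule wfUNIVI)
    fix P :: "hcset \<Rightarrow> bool" and x
    assume step: "\<forall>x. (\<forall>y. (y, x) \<in> {(x, y). x \<in> elts y} \<longrightarrow> P y) \<longrightarrow> P x"
    show "P x"
    proof (induction x)
      case (HC c)
      then show ?case
        using step by (simp add: elts_hcset_def cin.rep_eq)
    qed
  qed
next
  fix x y :: hcset
  show "\<exists>z. elts z = {x, y}" by (rule ex_elts_hcset) simp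
next
  fix x :: hcset
  show "\<exists>z. elts z = (\<Union>y\<in>elts x. elts y)"
    by (rule ex_elts_hcset) (simp add: countable_elts_hcset)
next
  fix x :: hcset and P :: "hcset \<Rightarrow> bool"
  show "\<exists>z. elts z = {y \<in> elts x. P y}"
    by (rule ex_elts_hcset) (simp add: countable_elts_hcset countable_Collect)
next
  fix x :: hcset and F :: "hcset \<Rightarrow> hcset"
  show "\<exists>z. elts z = F ` elts x"
    by (rule ex_elts_hcset) (simp add: countable_elts_hcset)
qed

end

section \<open>Predicatively computable set functions\<close>

text \<open>A function with \<open>n\<close> normal and \<open>m\<close> safe arguments takes a list of length \<open>n\<close> and a list of
  length \<open>m\<close>; functions in the class without normal arguments take the list of safe arguments only.
  Each clause requires its defining equation just for lists of these lengths, so membership does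
  not depend on the values at other lists. Positions are counted from \<open>0\<close>.\<close>

inductive PCSF_minus :: "nat \<Rightarrow> ('a::set_universe list \<Rightarrow> 'a) \<Rightarrow> bool" where
  proj: "PCSF_minus m f"
    if "j < m" "\<And>as. length as = m \<Longrightarrow> f as = as ! j"
| pair: "PCSF_minus 2 f"
    if "\<And>a b. f [a, b] = vset {a, b}"
| null: "PCSF_minus 0 f"
    if "f [] = vset {}"
| union: "PCSF_minus 1 f"
    if "\<And>a. f [a] = vset (\<Union>x\<in>elts a. elts x)"
| cond: "PCSF_minus 4 f"
    if "\<And>a b c d. f [a, b, c, d] = (if c \<in> elts d then a else b)"
| comp: "PCSF_minus m f"
    if "PCSF_minus (length ts) h" "\<forall>t\<in>set ts. PCSF_minus m t"
      "\<And>as. length as = m \<Longrightarrow> f as = h (map (\<lambda>t. t as) ts)"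
| sep: "PCSF_minus (Suc m) f"
    if "PCSF_minus (Suc m) h"
      "\<And>as c. length as = m \<Longrightarrow> f (as @ [c]) = vset {b \<in> elts c. h (as @ [b]) \<noteq> vset {}}"

text \<open>In clause \<open>rec\<close> the equation determines \<open>f\<close> on the relevant lists, as \<open>\<in>\<close> is well-founded.\<close>

inductive PCSF :: "nat \<Rightarrow> nat \<Rightarrow> ('a::set_universe list \<Rightarrow> 'a list \<Rightarrow> 'a) \<Rightarrow> bool" where
  minus: "PCSF 0 m f"
    if "PCSF_minus m g" "\<And>as. length as = m \<Longrightarrow> f [] as = g as"
| proj: "PCSF n m f"
    if "j < n + m"
      "\<And>xs as. length xs = n \<Longrightarrow> length as = m \<Longrightarrow> f xs as = (xs @ as) ! j"
| comp: "PCSF n m f"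
    if "PCSF (length rs) (length ts) h" "\<forall>r\<in>set rs. PCSF n 0 r" "\<forall>t\<in>set ts. PCSF n m t"
      "\<And>xs as. length xs = n \<Longrightarrow> length as = m \<Longrightarrow>
         f xs as = h (map (\<lambda>r. r xs []) rs) (map (\<lambda>t. t xs as) ts)"
| rec: "PCSF (Suc n) m f"
    if "PCSF (Suc n) (Suc m) h"
      "\<And>x ys as. length ys = n \<Longrightarrow> length as = m \<Longrightarrow>
         f (x # ys) as = h (x # ys) (as @ [vset ((\<lambda>z. f (z # ys) as) ` elts x)])"

section \<open>Hereditarily finite sets and sizes of transitive closures\<close>

inductive hereditarily_finite :: "'a::set_universe \<Rightarrow> bool" where
  "finite (elts x) \<Longrightarrow> (\<And>y. y \<in> elts x \<Longrightarrow> hereditarily_finite y) \<Longrightarrow> hereditarily_finite x"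

text \<open>The least transitive collection that includes \<open>x\<close> (and so does not have \<open>x\<close> as a member).\<close>

definition TC :: "'a::set_universe \<Rightarrow> 'a set" where
  "TC x = (\<lambda>T. \<forall>y\<in>T. elts y \<subseteq> T) hull elts x"

text \<open>The value is in \<^typ>\<open>enat\<close> because \<^const>\<open>card\<close> sends infinite sets to \<open>0\<close>.\<close>

definition cT :: "'a::set_universe \<Rightarrow> enat" where
  "cT x = (if finite (TC x) then enat (card (TC x)) else \<infinity>)"

section \<open>Polynomials in several variables\<close>

text \<open>A polynomial maps each monomial, given by the exponents of the variables, to its
  coefficient, a natural number.\<close>

type_synonym mpolynomial = "(nat \<Rightarrow>\<^sub>0 nat) \<Rightarrow>\<^sub>0 nat"

definition mpoly_vars :: "mpolynomial \<Rightarrow> nat set" where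
  "mpoly_vars p = (\<Union>e\<in>Poly_Mapping.keys p. Poly_Mapping.keys e)"

definition mpoly_value :: "mpolynomial \<Rightarrow> (nat \<Rightarrow> 'b::comm_semiring_1) \<Rightarrow> 'b" where
  "mpoly_value p v =
     (\<Sum>e\<in>Poly_Mapping.keys p. of_nat (Poly_Mapping.lookup p e) *
        (\<Prod>i\<in>Poly_Mapping.keys e. v i ^ Poly_Mapping.lookup e i))"

end

theory Submission
  imports Defs
begin

text \<open>
  The bound is obtained by counting the sets that \<open>f\<close> adds, that is, the members of
  \<open>TC (f X A)\<close> outside the transitive closures of the safe arguments \<open>A\<close>. A function without normal
  arguments adds boundedly many sets, and these numbers are summed under composition. In general, if
  every \<open>TC (X ! i)\<close> has at most \<open>N \<ge> 2\<close> elements, then \<open>f\<close> adds at most \<open>N ^ k\<close> sets, whatever the safe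
  arguments are. For predicative recursion, every set added to \<open>f (x # ys) as\<close> is either a value
  \<open>f (z # ys) as\<close> with \<open>z \<in> TC x\<close> or added by \<open>h\<close> at one of the at most \<open>N + 1\<close> stages
  \<open>w \<in> insert x (TC x)\<close>. Finally, \<open>N\<close> is the maximum of \<open>2\<close> and the sizes of the normal arguments, so
  that \<open>N ^ k\<close> is at most \<open>2 ^ k\<close> plus the sum of the \<open>k\<close>-th powers of these sizes.
\<close>

section \<open>Transitive closures\<close>

lemma elts_subset_TC: "elts x \<subseteq> TC x"
  unfolding TC_def by (rule hull_subset)

lemma TC_least: "elts x \<subseteq> T \<Longrightarrow> (\<And>y. y \<in> T \<Longrightarrow> elts y \<subseteq> T) \<Longrightarrow> TC x \<subseteq> T"
  unfolding TC_def by (rule hull_minimal) auto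

lemma TC_trans: "y \<in> TC x \<Longrightarrow> elts y \<subseteq> TC x"
  unfolding TC_def hull_def by blast

lemma TC_mono_mem: "y \<in> TC x \<Longrightarrow> TC y \<subseteq> TC x"
  by (rule TC_least) (auto dest: TC_trans)

lemma TC_mono_elts: "elts x \<subseteq> elts y \<Longrightarrow> TC x \<subseteq> TC y"
  using elts_subset_TC[of y] TC_trans[of _ y] by (intro TC_least) auto

lemma TC_unfold: "TC x = elts x \<union> (\<Union>y\<in>elts x. TC y)"
proof
  show "TC x \<subseteq> elts x \<union> (\<Union>y\<in>elts x. TC y)"
  proof (rule TC_least)
    show "elts y \<subseteq> elts x \<union> (\<Union>y\<in>elts x. TC y)"
      if "y \<in> elts x \<union> (\<Union>y\<in>elts x. TC y)" for y
      using that
    proof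
      assume "y \<in> elts x"
      then show ?thesis
        using elts_subset_TC[of y] by blast
    next
      assume "y \<in> (\<Union>y\<in>elts x. TC y)"
      then show ?thesis
        using TC_trans[of y] by blast
    qed
  qed blast
  show "elts x \<union> (\<Union>y\<in>elts x. TC y) \<subseteq> TC x"
    using elts_subset_TC[of x] TC_mono_mem[of _ x] by blast
qed

text \<open>A union of transitive collections is transitive. This serves both the function
  \<open>union\<close> and, at the end, the union of the safe arguments.\<close>

lemma TC_Union:
  assumes "elts u = (\<Union>b\<in>B. elts b)"
  shows "TC u = (\<Union>b\<in>B. TC b)"
proof
  show "TC u \<subseteq> (\<Union>b\<in>B. TC b)"
  proof (rule TC_least)
    show "elts u \<subseteq> (\<Union>b\<in>B. TC b)"
      unfolding assms using elts_subset_TC by (rule UN_mono[OF order_refl])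
    show "elts y \<subseteq> (\<Union>b\<in>B. TC b)" if "y \<in> (\<Union>b\<in>B. TC b)" for y
      using that TC_trans[of y] by blast
  qed
  show "(\<Union>b\<in>B. TC b) \<subseteq> TC u"
    using assms by (intro UN_least TC_mono_elts) blast
qed

lemma finite_TC: "hereditarily_finite x \<Longrightarrow> finite (TC x)"
  by (induction rule: hereditarily_finite.induct) (subst TC_unfold, simp)

section \<open>Sets added to the safe arguments\<close>

definition added :: "'a::set_universe \<Rightarrow> 'a list \<Rightarrow> 'a set" where
  "added y as = TC y - (\<Union>a\<in>set as. TC a)"

text \<open>Finiteness is included because \<open>card\<close> sends infinite sets to 0.\<close>

definition card_le :: "'b set \<Rightarrow> nat \<Rightarrow> bool" where
  "card_le S c \<longleftrightarrow> finite S \<and> card S \<le> c"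

lemma card_le_mono: "card_le S c \<Longrightarrow> T \<subseteq> S \<Longrightarrow> c \<le> d \<Longrightarrow> card_le T d"
  unfolding card_le_def by (meson card_mono finite_subset le_trans)

lemma card_le_empty: "card_le {} c"
  by (simp add: card_le_def)

lemma card_le_Un: "card_le S c \<Longrightarrow> card_le T d \<Longrightarrow> card_le (S \<union> T) (c + d)"
  unfolding card_le_def by (meson add_mono card_Un_le finite_UnI le_trans)

lemma card_le_UN:
  assumes "card_le I n" "\<And>i. i \<in> I \<Longrightarrow> card_le (S i) c"
  shows "card_le (\<Union>i\<in>I. S i) (n * c)"
proof -
  have "card (\<Union>i\<in>I. S i) \<le> (\<Sum>i\<in>I. card (S i))"
    using assms by (intro card_UN_le) (simp add: card_le_def)
  also have "\<dots> \<le> card I * c"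
    using assms sum_bounded_above[of I "\<lambda>i. card (S i)" c] by (simp add: card_le_def)
  also have "\<dots> \<le> n * c"
    using assms by (simp add: card_le_def)
  finally show ?thesis
    using assms by (simp add: card_le_def)
qed

lemma card_le_image: "card_le I n \<Longrightarrow> card_le (g ` I) n"
  unfolding card_le_def by (meson card_image_le finite_imageI le_trans)

text \<open>A set in \<open>TC y\<close> that is not added to the values \<open>g t\<close> lies in
  some \<open>TC (g t)\<close>; so it is added there or already lies in the closure of a member of
  \<open>as\<close>.\<close>

lemma added_comp:
  assumes "card_le (added y (map g ts)) c" "\<And>t. t \<in> set ts \<Longrightarrow> card_le (added (g t) as) d"
  shows "card_le (added y as) (c + length ts * d)"
proof -
  have "card_le (set ts) (length ts)"
    by (simp add: card_le_def card_length)
  then have "card_le (added y (map g ts) \<union> (\<Union>t\<in>set ts. added (g t) as)) (c + length ts * d)"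
    by (intro card_le_Un card_le_UN assms)
  then show ?thesis
    by (rule card_le_mono) (auto simp: added_def)
qed

text \<open>Induction gives each function in a list its own bound; upward closure lets the maximum
  serve all of them.\<close>

lemma uniform_bound:
  fixes P :: "'b \<Rightarrow> nat \<Rightarrow> bool"
  assumes "finite S" "\<And>t. t \<in> S \<Longrightarrow> \<exists>c. P t c" "\<And>t c d. P t c \<Longrightarrow> c \<le> d \<Longrightarrow> P t d"
  shows "\<exists>c. \<forall>t\<in>S. P t c"
  using assms(1,2)
proof (induction S)
  case (insert t S)
  then obtain c d where "\<forall>t\<in>S. P t c" "P t d" by blast
  then have "\<forall>s\<in>insert t S. P s (max c d)"
    using assms(3) by (metis insert_iff max.cobounded1 max.cobounded2)
  then show ?case ..
qed simp

text \<open>Among the initial functions only \<open>pair\<close> can add sets, namely its two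
  members. A separation is a subset of its last argument and adds nothing; composition combines
  constants by \<open>added_comp\<close>.\<close>

lemma PCSF_minus_added:
  "PCSF_minus m f \<Longrightarrow> \<exists>c. \<forall>as. length as = m \<longrightarrow> card_le (added (f as) as) c"
proof (induction rule: PCSF_minus.induct)
  case (proj j m f)
  then have "added (f as) as = {}" if "length as = m" for as
    using that by (fastforce simp: added_def)
  then show ?case
    by (simp add: card_le_empty)
next
  case (pair f)
  have "added (f [a, b]) [a, b] \<subseteq> {a, b}" for a b
    by (subst added_def, subst TC_unfold) (auto simp: pair elts_vset_pair)
  moreover have "card_le {a, b} 2" for a b :: 'a
    by (simp add: card_le_def card_insert_if)
  ultimately have "card_le (added (f [a, b]) [a, b]) 2" for a b
    by (meson card_le_mono order_refl)
  then show ?case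
    by (intro exI[of _ 2]) (auto simp: numeral_2_eq_2 length_Suc_conv)
next
  case (null f)
  have "TC (f []) = {}"
    by (subst TC_unfold) (simp add: null elts_vset_empty)
  then show ?case
    by (simp add: added_def card_le_empty)
next
  case (union f)
  have "TC (f [a]) \<subseteq> TC a" for a
  proof -
    have "TC (f [a]) = (\<Union>x\<in>elts a. TC x)"
      by (rule TC_Union) (simp add: union elts_vset_Union)
    then show ?thesis
      using TC_unfold[of a] by blast
  qed
  then have "added (f [a]) [a] = {}" for a
    by (simp add: added_def)
  then show ?case
    by (auto simp: length_Suc_conv card_le_empty)
next
  case (cond f)
  have "added (f [a, b, c, d]) [a, b, c, d] = {}" for a b c d
    by (auto simp: added_def cond)
  then show ?case
    by (auto simp: numeral_eq_Suc length_Suc_conv card_le_empty)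
next
  case (comp ts h m f)
  then obtain c where c: "\<And>as. length as = length ts \<Longrightarrow> card_le (added (h as) as) c"
    by blast
  have "\<exists>d. \<forall>t\<in>set ts. \<forall>as. length as = m \<longrightarrow> card_le (added (t as) as) d"
    using comp by (intro uniform_bound) (auto intro: card_le_mono[OF _ order_refl])
  then obtain d where "\<And>t as. t \<in> set ts \<Longrightarrow> length as = m \<Longrightarrow> card_le (added (t as) as) d"
    by blast
  then have "card_le (added (f as) as) (c + length ts * d)" if "length as = m" for as
    using that comp c by (intro added_comp[of _ "\<lambda>t. t as" ts]) auto
  then show ?case by blast
next
  case (sep m h f)
  have "added (f as) as = {}" if "length as = Suc m" for as
  proof -
    from that obtain bs c where as: "as = bs @ [c]" "length bs = m"
      by (metis length_Suc_conv_rev)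
    then have "elts (f as) \<subseteq> elts c"
      by (simp add: sep elts_vset_sep)
    then show ?thesis
      using as TC_mono_elts by (auto simp: added_def)
  qed
  then show ?case
    by (simp add: card_le_empty)
qed

text \<open>The constant is absorbed by \<open>Suc c \<le> 2 ^ Suc c \<le> N ^ Suc c\<close>. Thus
  all bounds stay pure powers of \<open>N\<close>.\<close>

lemma power_le_absorb:
  fixes N c k l :: nat
  assumes "2 \<le> N"
  shows "N ^ k + c * N ^ l \<le> N ^ (k + l + Suc c)"
proof -
  have "Suc c \<le> 2 ^ Suc c"
    using less_exp[of "Suc c"] by simp
  also have "\<dots> \<le> N ^ Suc c"
    using assms by (rule power_mono) simp
  finally have "Suc c * N ^ (k + l) \<le> N ^ Suc c * N ^ (k + l)"
    by (rule mult_right_mono) simp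
  moreover have "N ^ k \<le> N ^ (k + l)" "c * N ^ l \<le> c * N ^ (k + l)"
    using assms by (auto intro!: power_increasing mult_left_mono)
  ultimately have "N ^ k + c * N ^ l \<le> N ^ Suc c * N ^ (k + l)"
    unfolding mult_Suc by linarith
  then show ?thesis
    by (simp add: power_add mult_ac)
qed

text \<open>With pure powers of one common bound \<open>N\<close>, substituting a bound into another
  multiplies exponents. The sizes of the safe arguments are unrestricted, so a recursion can pass
  the set of earlier values there.\<close>

definition poly_added :: "nat \<Rightarrow> nat \<Rightarrow> ('a::set_universe list \<Rightarrow> 'a list \<Rightarrow> 'a) \<Rightarrow> nat \<Rightarrow> bool" where
  "poly_added n m f k \<longleftrightarrow> (\<forall>N xs as. 2 \<le> N \<longrightarrow> length xs = n \<longrightarrow> length as = m \<longrightarrow>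
     (\<forall>x\<in>set xs. card_le (TC x) N) \<longrightarrow> card_le (added (f xs as) as) (N ^ k))"

lemma poly_addedD:
  "poly_added n m f k \<Longrightarrow> 2 \<le> N \<Longrightarrow> length xs = n \<Longrightarrow> length as = m \<Longrightarrow>
   (\<And>x. x \<in> set xs \<Longrightarrow> card_le (TC x) N) \<Longrightarrow> card_le (added (f xs as) as) (N ^ k)"
  by (simp add: poly_added_def)

lemma poly_added_mono: "poly_added n m f k \<Longrightarrow> k \<le> l \<Longrightarrow> poly_added n m f l"
  unfolding poly_added_def
  by (intro allI impI, rule card_le_mono[OF _ order_refl power_increasing[of k l]]) simp_all

text \<open>The closure of the set of earlier values consists of these values and their closures, so
  induction along membership unravels the recursion. The union over stages in \<open>TC x\<close>
  counts each stage once, however many membership paths lead to it, which avoids exponential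
  growth.\<close>

lemma added_rec:
  fixes f :: "'a::set_universe \<Rightarrow> 'a"
  assumes f: "\<And>x. f x = h x (as @ [vset (f ` elts x)])"
  shows "added (f x) as \<subseteq>
    (\<Union>w\<in>insert x (TC x). added (f w) (as @ [vset (f ` elts w)])) \<union> f ` TC x"
proof (induction x rule: wf_induct_rule[OF elts_wf])
  case (1 x)
  let ?R = "\<lambda>x. (\<Union>w\<in>insert x (TC x). added (f w) (as @ [vset (f ` elts w)])) \<union> f ` TC x"
  have R_mono: "?R z \<subseteq> ?R x" if "z \<in> elts x" for z
  proof -
    have "z \<in> TC x" "TC z \<subseteq> TC x"
      using that elts_subset_TC TC_mono_mem by blast+
    then show ?thesis by blast
  qed
  have IH: "added (f z) as \<subseteq> ?R x" if "z \<in> elts x" for z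
    using 1[of z] R_mono[OF that] that by blast
  have "TC (vset (f ` elts x)) = f ` elts x \<union> (\<Union>z\<in>elts x. TC (f z))"
    by (subst TC_unfold) (simp add: elts_vset_image)
  then have "added (f x) as \<subseteq>
      added (f x) (as @ [vset (f ` elts x)]) \<union> f ` elts x \<union> (\<Union>z\<in>elts x. added (f z) as)"
    by (auto simp: added_def)
  also have "\<dots> \<subseteq> ?R x"
    using IH elts_subset_TC[of x] by (intro Un_least UN_least) auto
  finally show ?case .
qed

lemma PCSF_poly_added: "PCSF n m f \<Longrightarrow> \<exists>k. poly_added n m f k"
proof (induction rule: PCSF.induct)
  case (minus m g f)
  then obtain c where c: "\<And>as. length as = m \<Longrightarrow> card_le (added (g as) as) c"
    using PCSF_minus_added by blast
  \<comment> \<open>The constant becomes a power through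
    \<open>c < 2 ^ c \<le> N ^ c\<close>.\<close>
  have "c \<le> N ^ c" if "2 \<le> N" for N :: nat
    using less_exp[of c] power_mono[OF that, of c] by linarith
  then have "card_le (added (f [] as) as) (N ^ c)" if "2 \<le> N" "length as = m" for as N
    using that minus by (auto intro: card_le_mono[OF c order_refl])
  then have "poly_added 0 m f c"
    by (simp add: poly_added_def)
  then show ?case ..
next
  case (proj j n m f)
  have "card_le (added (f xs as) as) (N ^ 1)"
    if "length xs = n" "length as = m" "\<forall>x\<in>set xs. card_le (TC x) N" for xs as N
  proof (cases "j < n")
    case True
    then have "card_le (TC (f xs as)) N"
      using that proj by (simp add: nth_append)
    then show ?thesis
      by (rule card_le_mono) (auto simp: added_def)
  next
    case False
    then have "f xs as \<in> set as"
      using that proj by (simp add: nth_append)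
    then show ?thesis
      by (intro card_le_mono[OF card_le_empty]) (auto simp: added_def)
  qed
  then have "poly_added n m f 1"
    by (simp add: poly_added_def)
  then show ?case ..
next
  case (comp rs ts h n m f)
  then obtain k where k: "poly_added (length rs) (length ts) h k" by blast
  have "\<exists>l. \<forall>r\<in>set rs. poly_added n 0 r l"
    using comp by (intro uniform_bound) (auto intro: poly_added_mono)
  then obtain l0 where "\<forall>r\<in>set rs. poly_added n 0 r l0" ..
  \<comment> \<open>A positive exponent keeps the new base \<open>N ^ Suc l0\<close> at least 2, as
    the bound for \<open>h\<close> requires.\<close>
  then have l: "\<forall>r\<in>set rs. poly_added n 0 r (Suc l0)"
    by (auto intro: poly_added_mono)
  have "\<exists>d. \<forall>t\<in>set ts. poly_added n m t d"
    using comp by (intro uniform_bound) (auto intro: poly_added_mono)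
  then obtain d where d: "\<forall>t\<in>set ts. poly_added n m t d" ..
  let ?k = "Suc l0 * k + d + Suc (length ts)"
  have "card_le (added (f xs as) as) (N ^ ?k)"
    if N: "2 \<le> N" and xs: "length xs = n" "\<And>x. x \<in> set xs \<Longrightarrow> card_le (TC x) N"
      and as: "length as = m" for xs as and N :: nat
  proof -
    \<comment> \<open>Without safe arguments all of \<open>TC (r xs [])\<close> counts as added, so
      the bound on added sets limits the sizes of the normal arguments of \<open>h\<close>.\<close>
    have r: "card_le (TC (r xs [])) (N ^ Suc l0)" if "r \<in> set rs" for r
      using poly_addedD[OF l[rule_format, OF that] N xs(1) _ xs(2), of "[]"]
      by (simp add: added_def)
    have t: "card_le (added (t xs as) as) (N ^ d)" if "t \<in> set ts" for t
      using poly_addedD[OF d[rule_format, OF that] N xs(1) as xs(2)] .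
    have "2 \<le> N ^ Suc l0"
      using N self_le_power[of N "Suc l0"] by linarith
    then have "card_le (added (f xs as) (map (\<lambda>t. t xs as) ts)) ((N ^ Suc l0) ^ k)"
      using comp.hyps(2)[OF xs(1) as] r by (auto intro!: poly_addedD[OF k])
    then have "card_le (added (f xs as) as) ((N ^ Suc l0) ^ k + length ts * N ^ d)"
      using t by (rule added_comp)
    then show ?thesis
      using power_le_absorb[OF N, of "Suc l0 * k" "length ts" d]
      by (metis card_le_mono order_refl power_mult)
  qed
  then have "poly_added n m f ?k"
    by (simp add: poly_added_def)
  then show ?case ..
next
  case (rec n m h f)
  then obtain k where k: "poly_added (Suc n) (Suc m) h k" by blast
  \<comment> \<open>The exponent is what \<open>power_le_absorb\<close> yields for
    \<open>N ^ Suc k + 2 * N ^ Suc k\<close>.\<close>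
  have "card_le (added (f xs as) as) (N ^ (Suc k + Suc k + Suc 2))"
    if N: "2 \<le> N" and xs: "length xs = Suc n" "\<And>x. x \<in> set xs \<Longrightarrow> card_le (TC x) N"
      and as: "length as = m" for xs as and N :: nat
  proof -
    obtain x ys where xs_eq: "xs = x # ys" and ys: "length ys = n"
      using xs(1) by (auto simp: length_Suc_conv)
    let ?g = "\<lambda>z. f (z # ys) as"
    have x: "card_le (TC x) N"
      using xs xs_eq by simp
    \<comment> \<open>Every stage satisfies \<open>TC w \<subseteq> TC x\<close>, so the same
      \<open>N\<close> serves the whole recursion.\<close>
    have "card_le (added (?g w) (as @ [vset (?g ` elts w)])) (N ^ k)"
      if "w \<in> insert x (TC x)" for w
    proof -
      have "card_le (TC w) N"
        using that TC_mono_mem by (auto intro: card_le_mono[OF x])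
      then show ?thesis
        unfolding rec.hyps(2)[OF ys as, of w] using xs ys as xs_eq
        by (intro poly_addedD[OF k N]) auto
    qed
    moreover have "card_le (insert x (TC x)) (N + 1)"
      using card_le_Un[OF x, of "{x}" 1] by (simp add: card_le_def)
    ultimately have "card_le ((\<Union>w\<in>insert x (TC x). added (?g w) (as @ [vset (?g ` elts w)]))
        \<union> ?g ` TC x) ((N + 1) * N ^ k + N)"
      using x by (intro card_le_Un card_le_UN card_le_image)
    moreover have "added (?g x) as \<subseteq>
        (\<Union>w\<in>insert x (TC x). added (?g w) (as @ [vset (?g ` elts w)])) \<union> ?g ` TC x"
      using rec.hyps(2)[OF ys as] by (rule added_rec)
    ultimately have "card_le (added (?g x) as) ((N + 1) * N ^ k + N)"
      by (rule card_le_mono) simp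
    moreover have "(N + 1) * N ^ k + N \<le> N ^ (Suc k + Suc k + Suc 2)"
    proof -
      have "N ^ k \<le> N ^ Suc k" "N \<le> N ^ Suc k"
        using N by (auto intro: power_increasing self_le_power)
      then have "(N + 1) * N ^ k + N \<le> N ^ Suc k + 2 * N ^ Suc k"
        unfolding distrib_right power_Suc by linarith
      also have "\<dots> \<le> N ^ (Suc k + Suc k + Suc 2)"
        using N by (rule power_le_absorb)
      finally show ?thesis .
    qed
    ultimately show ?thesis
      unfolding xs_eq by (rule card_le_mono[OF _ order_refl])
  qed
  then have "poly_added (Suc n) m f (Suc k + Suc k + Suc 2)"
    by (simp add: poly_added_def)
  then show ?case ..
qed

section \<open>Polynomials\<close>

text \<open>Keys outside the support have coefficient zero, so \<open>p\<close>, \<open>q\<close>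
  and \<open>p + q\<close> can be evaluated over one common index set.\<close>

lemma mpoly_value_superset:
  assumes "finite S" "Poly_Mapping.keys p \<subseteq> S"
  shows "mpoly_value p v = (\<Sum>e\<in>S. of_nat (Poly_Mapping.lookup p e) *
    (\<Prod>i\<in>Poly_Mapping.keys e. v i ^ Poly_Mapping.lookup e i))"
  unfolding mpoly_value_def using assms
  by (intro sum.mono_neutral_left) (auto simp: in_keys_iff)

lemma mpoly_value_add: "mpoly_value (p + q) v = mpoly_value p v + mpoly_value q v"
proof -
  let ?S = "Poly_Mapping.keys p \<union> Poly_Mapping.keys q"
  have "finite ?S" by simp
  then show ?thesis
    using Poly_Mapping.keys_add[of p q]
    by (simp add: mpoly_value_superset[of ?S] lookup_add distrib_right sum.distrib)
qed

lemma mpoly_value_single: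
  "mpoly_value (Poly_Mapping.single e c) v =
    of_nat c * (\<Prod>i\<in>Poly_Mapping.keys e. v i ^ Poly_Mapping.lookup e i)"
  by (simp add: mpoly_value_def)

text \<open>This is \<open>c + x_0 ^ k + ... + x_(n-1) ^ k\<close>: the key \<open>0\<close> is the
  constant monomial, and \<open>single i k\<close> is the power of variable
  \<open>i\<close>.\<close>

definition power_sum_poly :: "nat \<Rightarrow> nat \<Rightarrow> nat \<Rightarrow> mpolynomial" where
  "power_sum_poly c k n = Poly_Mapping.single 0 c +
     (\<Sum>i<n. Poly_Mapping.single (Poly_Mapping.single i k) 1)"

lemma mpoly_vars_add: "mpoly_vars (p + q) \<subseteq> mpoly_vars p \<union> mpoly_vars q"
  using Poly_Mapping.keys_add[of p q] by (auto simp: mpoly_vars_def)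

lemma power_sum_poly_Suc:
  "power_sum_poly c k (Suc n) =
    power_sum_poly c k n + Poly_Mapping.single (Poly_Mapping.single n k) 1"
  by (simp add: power_sum_poly_def add.assoc)

lemma mpoly_vars_power_sum_poly: "mpoly_vars (power_sum_poly c k n) \<subseteq> {..<n}"
proof (induction n)
  case 0
  show ?case by (simp add: power_sum_poly_def mpoly_vars_def)
next
  case (Suc n)
  have "mpoly_vars (Poly_Mapping.single (Poly_Mapping.single n k) 1) \<subseteq> {n}"
    by (simp add: mpoly_vars_def)
  with Suc show ?case
    using mpoly_vars_add[of "power_sum_poly c k n"] by (fastforce simp: power_sum_poly_Suc)
qed

lemma mpoly_value_power_sum_poly:
  "mpoly_value (power_sum_poly c k n) v = of_nat c + (\<Sum>i<n. v i ^ k)"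
proof (induction n)
  case 0
  show ?case by (simp add: power_sum_poly_def mpoly_value_single)
next
  case (Suc n)
  then show ?case
    by (simp add: power_sum_poly_Suc mpoly_value_add mpoly_value_single add.assoc)
qed

lemma enat_power: "enat (a ^ k) = enat a ^ k"
  by (induction k) (simp_all add: one_enat_def flip: times_enat_simps(1))

lemma enat_sum: "enat (sum g I) = (\<Sum>i\<in>I. enat (g i))"
  by (induction I rule: infinite_finite_induct) (simp_all add: zero_enat_def flip: plus_enat_simps(1))

text \<open>The maximum is attained, so its power is one of the summands. A maximum, which is no
  polynomial, is thereby replaced by a sum.\<close>

lemma Max_power_le_sum:
  fixes g :: "nat \<Rightarrow> nat"
  shows "Max (insert c (g ` {..<n})) ^ k \<le> c ^ k + (\<Sum>i<n. g i ^ k)"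
proof -
  have "Max (insert c (g ` {..<n})) \<in> insert c (g ` {..<n})"
    by (rule Max_in) auto
  then consider "Max (insert c (g ` {..<n})) = c"
    | i where "i < n" "Max (insert c (g ` {..<n})) = g i"
    by blast
  then show ?thesis
  proof cases
    case 2
    then show ?thesis
      using member_le_sum[of i "{..<n}" "\<lambda>i. g i ^ k"] by simp
  qed simp
qed

theorem theorem5p1:
  fixes f :: "'a::set_universe list \<Rightarrow> 'a list \<Rightarrow> 'a" and n m :: nat
  assumes "PCSF n m f"
  shows "\<exists>p :: mpolynomial. mpoly_vars p \<subseteq> {..<n} \<and>
    (\<forall>X A. length X = n \<and> length A = m \<and>
       (\<forall>x\<in>set X. hereditarily_finite x) \<and> (\<forall>a\<in>set A. hereditarily_finite a) \<longrightarrow>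
       cT (f X A) \<le> mpoly_value p (\<lambda>i. cT (X ! i)) + cT (vset (\<Union>a\<in>set A. elts a)))"
proof -
  obtain k where k: "poly_added n m f k"
    using PCSF_poly_added[OF assms] ..
  have "cT (f X A) \<le> mpoly_value (power_sum_poly (2 ^ k) k n) (\<lambda>i. cT (X ! i))
      + cT (vset (\<Union>a\<in>set A. elts a))"
    if X: "length X = n" "\<forall>x\<in>set X. hereditarily_finite x"
      and A: "length A = m" "\<forall>a\<in>set A. hereditarily_finite a" for X A
  proof -
    let ?g = "\<lambda>i. card (TC (X ! i))" and ?U = "\<Union>a\<in>set A. TC a"
    \<comment> \<open>Inserting 2 supplies the base that \<open>poly_added\<close> requires and
      keeps the set nonempty when \<open>n = 0\<close>.\<close>
    define N where "N = Max (insert 2 (?g ` {..<n}))"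
    have finX: "finite (TC (X ! i))" if "i < n" for i
      using that X by (simp add: finite_TC)
    have finU: "finite ?U"
      using A by (simp add: finite_TC)
    \<comment> \<open>The sets excluded from \<open>added\<close> are thus exactly those counted by
      the last summand of the claimed bound.\<close>
    have TCU: "TC (vset (\<Union>a\<in>set A. elts a)) = ?U"
      by (rule TC_Union) (simp add: elts_vset_finite_Union)
    have "2 \<le> N" and "?g i \<le> N" if "i < n" for i
      using that by (simp_all add: N_def)
    then have "card_le (TC x) N" if "x \<in> set X" for x
      using that X finX by (auto simp: card_le_def in_set_conv_nth)
    moreover have "2 \<le> N"
      by (simp add: N_def)
    ultimately have "card_le (added (f X A) A) (N ^ k)"
      using k X A by (intro poly_addedD) auto
    then have "card_le (added (f X A) A \<union> ?U) (N ^ k + card ?U)"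
      using finU by (intro card_le_Un) (simp_all add: card_le_def)
    then have "card_le (TC (f X A)) (N ^ k + card ?U)"
      by (rule card_le_mono) (auto simp: added_def)
    then have "card_le (TC (f X A)) (2 ^ k + (\<Sum>i<n. ?g i ^ k) + card ?U)"
      by (rule card_le_mono) (use Max_power_le_sum[of 2 ?g n k] in \<open>simp_all add: N_def\<close>)
    then have "cT (f X A) \<le> enat (2 ^ k + (\<Sum>i<n. ?g i ^ k) + card ?U)"
      by (simp add: cT_def card_le_def)
    also have "\<dots> = enat (2 ^ k) + (\<Sum>i<n. enat (?g i) ^ k) + enat (card ?U)"
      by (simp add: enat_sum enat_power flip: plus_enat_simps(1))
    also have "\<dots> = mpoly_value (power_sum_poly (2 ^ k) k n) (\<lambda>i. cT (X ! i))
        + cT (vset (\<Union>a\<in>set A. elts a))"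
      using finX finU by (simp add: mpoly_value_power_sum_poly TCU cT_def of_nat_eq_enat)
    finally show ?thesis .
  qed
  then show ?thesis
    using mpoly_vars_power_sum_poly by blast
qed

end
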